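(* Let $(\kappa_k)$, $(\tau_k)$ be a given solution to the ($SL(2)$-invariant) Euler–Lagrange equations $$0=(\mathrm{id}-\mathrm{S}_{-1})\big(\kappa \mathrm{E}_\kappa(L)\big)+(\mathrm{id}+\mathrm{S}_{-1})\big(\tau \mathrm{E}_\tau(L)\big),$$ $$0=-\mathrm{S}_{-2}\Big(\frac{\tau}{\tau_1^2}\mathrm{E}_\kappa(L)\Big)+\frac1\tau \mathrm{E}_\kappa(L)+\mathrm{S}_{-1}\big(\kappa \mathrm{E}_\tau(L)\big),$$ so that the vectors of invariants $\mathrm{S}_kV(I)=(V^1_k,V^2_k,V^3_k)$ appearing in the conservation laws $\mathbf{k}=V(I)\,\mathcal{A}d(\rho_0)$ are known, and suppose that $V^2_k\neq 0$ for all $k$. Suppose further that the three constants $\mathbf{k}=(k_1,k_2,k_3)$ in the conservation laws are given and satisfy $k_3(k_1^2+4k_2k_3)\neq 0$. Then the general solution to the Euler–Lagrange equations, in terms of $(x_k,y_k)$, is $$\begin{pmatrix} x_k\\ y_k\end{pmatrix}=\begin{pmatrix}0&1\\-1&0\end{pmatrix}Q\begin{pmatrix}\prod_{l=0}^{k-1}\zeta_l\lambda_{1,l}&0\\0&\prod_{l=0}^{k-1}\zeta_l\lambda_{2,l}\end{pmatrix}Q^{-1}\begin{pmatrix}c_0\\ d_0\end{pmatrix},$$ where $c_0$ and $d_0$ are two further arbitrary constants of integration, $$Q=\begin{pmatrix}k_1-\sqrt{k_1^2+4k_2k_3} & k_1+\sqrt{k_1^2+4k_2k_3}\\ 2k_3&2k_3\end{pmatrix},$$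 and $$\lambda_{1,l}=V^1_l-\sqrt{k_1^2+4k_2k_3},\qquad \lambda_{2,l}=V^1_l+\sqrt{k_1^2+4k_2k_3},\qquad \zeta_l=-\frac{\tau_l}{2V^2_l}.$$
   Context: The group $SL(2)$ (real or complex) acts linearly on the plane, $(x,y)^T\mapsto g(x,y)^T$, $g=\begin{pmatrix}a&b\\c&d\end{pmatrix}$, $ad-bc=1$, and diagonally on sequences $(x_j,y_j)$, $j\in\mathbb{Z}$. $\mathrm{S}$ is the shift operator ($x_j\mapsto x_{j+1}$, $y_j\mapsto y_{j+1}$, extended to functions), $\mathrm{S}_k$ its $k$-th power and $\mathrm{id}$ the identity; a subscript $k$ on an invariant denotes $\mathrm{S}_k$ applied to it ($\kappa_k=\mathrm{S}_k\kappa$, $\tau_k=\mathrm{S}_k\tau$, $V^i_k=\mathrm{S}_kV^i_0$). Generating invariants: $\tau=x_0y_1-x_1y_0$ and $\kappa=\dfrac{x_0y_2-x_2y_0}{x_1y_2-x_2y_1}$. Discrete moving frame: $\rho_0=\begin{pmatrix} y_1/\tau & -x_1/\tau\\ -y_0&x_0\end{pmatrix}\in SL(2)$, $\rho_k=\mathrm{S}_k\rho_0=\begin{pmatrix}a_k&b_k\\c_k&d_k\end{pmatrix}$, so that $\rho_k(x_k,y_k)^T=(1,0)^T$ and $\rho_{k+1}=(\mathrm{S}_kK_0)\rho_k$ with $K_0=\begin{pmatrix}\kappa&1/\tau\\-\tau&0\end{pmatrix}$. In particular $(c_0,d_0)$ denotes the second row of $\rho_0$, i.e. the initial data for the frame.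 The Lagrangian is $\mathcal{L}[x,y]=\sum L(\tau,\tau_1,\dots,\tau_{J_1},\kappa,\kappa_1,\dots,\kappa_{J_2})$, with sum over the lattice variable $n$, and the difference Euler operators are $\mathrm{E}_\kappa(L)=\sum_j \mathrm{S}_{-j}\big(\partial L/\partial\kappa_j\big)$, $\mathrm{E}_\tau(L)=\sum_j\mathrm{S}_{-j}\big(\partial L/\partial\tau_j\big)$. The two equations in the claim are the invariant form of the Euler–Lagrange equations of $\mathcal{L}$ with respect to $(x,y)$. Adjoint representation: $$\mathcal{A}d(g)=\begin{pmatrix} ad+bc&-ac&bd\\-2ab&a^2&-b^2\\2cd&-c^2&d^2\end{pmatrix}.$$ Noether's conservation laws are $\mathbf{k}=V(I)\,\mathcal{A}d(\rho_0)$, with $\mathbf{k}=(k_1,k_2,k_3)$ a constant row vector and $V(I)=(V^1_0,V^2_0,V^3_0)$ the row vector of invariants $$V(I)=\mathcal{C}^x_0\,(1\ 0\ 0)+\mathcal{C}^y_0\,(0\ 0\ 1)+\mathcal{C}^y_1\,(0\ 0\ 1)\,\mathcal{A}d(K_0),$$ where $$\mathcal{C}^x_0=-\mathrm{S}_{-1}(\kappa \mathrm{E}_\kappa(L))+\mathrm{S}_{-1}(\tau \mathrm{E}_\tau(L)),\quad \mathcal{C}^y_0=\mathrm{S}_{-1}(\kappa \mathrm{E}_\tau(L))-\mathrm{S}_{-2}\Big(\frac{\tau}{\tau_1^2}\mathrm{E}_\kappa(L)\Big),\quad \mathcal{C}^y_1=-\mathrm{S}_{-1}\Big(\frac{\tau}{\tau_1^2}\mathrm{E}_\kappa(L)\Big).$$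 The square root $\sqrt{k_1^2+4k_2k_3}$ is a fixed (possibly complex) square root; empty products equal $1$ and $k\ge 0$ in the formula.
   Formalization: The constants c_0, d_0 are not fully arbitrary: (c_0,d_0) must be the second row of some g in SL(2) with k = V(I)Ad(g), as other choices (e.g. a doubled pair) change τ; the Lagrangian is assumed differentiable along the given solution. *)

theory Defs
  imports "HOL-Analysis.Analysis"
begin

text \<open>
  The scalars are a type of class \<open>real_normed_field\<close>; by the Gelfand-Mazur theorem its
  instances are, up to isomorphism, exactly the real and the complex numbers.  A sequence
  $(x_j,y_j)_{j\in Z}$ in the plane is a function \<open>z :: int \<Rightarrow> 'a^2\<close> with
  \<open>x j = z j $ 1\<close> and \<open>y j = z j $ 2\<close>.  An invariant is represented by the sequence of
  all its shifts.
\<close>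

definition shift :: "int \<Rightarrow> (int \<Rightarrow> 'b) \<Rightarrow> int \<Rightarrow> 'b" where
  "shift m f = (\<lambda>n. f (n + m))"

definition mat2 :: "'a \<Rightarrow> 'a \<Rightarrow> 'a \<Rightarrow> 'a \<Rightarrow> 'a::zero^2^2" where
  "mat2 a b c d = vector [vector [a, b], vector [c, d]]"

definition tau_of :: "(int \<Rightarrow> 'a::real_normed_field^2) \<Rightarrow> int \<Rightarrow> 'a" where
  "tau_of z n = z n $ 1 * z (n+1) $ 2 - z (n+1) $ 1 * z n $ 2"

definition kappa_of :: "(int \<Rightarrow> 'a::real_normed_field^2) \<Rightarrow> int \<Rightarrow> 'a" where
  "kappa_of z n = (z n $ 1 * z (n+2) $ 2 - z (n+2) $ 1 * z n $ 2) /
                  (z (n+1) $ 1 * z (n+2) $ 2 - z (n+2) $ 1 * z (n+1) $ 2)"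

definition frame :: "(int \<Rightarrow> 'a::real_normed_field^2) \<Rightarrow> int \<Rightarrow> 'a^2^2" where
  "frame z n = mat2 (z (n+1) $ 2 / tau_of z n) (- z (n+1) $ 1 / tau_of z n)
                    (- z n $ 2) (z n $ 1)"

definition K_mat :: "'a::real_normed_field \<Rightarrow> 'a \<Rightarrow> 'a^2^2" where
  "K_mat \<kappa> \<tau> = mat2 \<kappa> (1 / \<tau>) (- \<tau>) 0"

definition Ad :: "'a::real_normed_field^2^2 \<Rightarrow> 'a^3^3" where
  "Ad g = (let a = g$1$1; b = g$1$2; c = g$2$1; d = g$2$2 in
     vector [vector [a*d + b*c, - (a*c), b*d],
             vector [- (2*a*b), a^2, - (b^2)],
             vector [2*c*d, - (c^2), d^2]])"


text \<open>
  The summand of the Lagrangian is a function \<open>L ts ks\<close> of the lists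
  \<open>ts = [\<tau>, \<tau>\<^sub>1, ...]\<close> of length \<open>J1 + 1\<close> and \<open>ks = [\<kappa>, \<kappa>\<^sub>1, ...]\<close> of length
  \<open>J2 + 1\<close>; its values on lists of other lengths are never used.
\<close>

type_synonym 'a lagrangian = "'a list \<Rightarrow> 'a list \<Rightarrow> 'a"

definition window :: "nat \<Rightarrow> (int \<Rightarrow> 'a) \<Rightarrow> int \<Rightarrow> 'a list" where
  "window J f n = map (\<lambda>j. f (n + int j)) [0..<Suc J]"

text \<open>Total (Frechet) differentiability of \<open>L\<close> in its finitely many arguments.\<close>

definition lagrangian_differentiable_at ::
    "'a::real_normed_field lagrangian \<Rightarrow> 'a list \<Rightarrow> 'a list \<Rightarrow> bool" where
  "lagrangian_differentiable_at L ts ks \<longleftrightarrow>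
     (\<exists>p q. \<forall>\<epsilon>>0. \<exists>\<delta>>0. \<forall>ts' ks'.
        length ts' = length ts \<and> length ks' = length ks \<and>
        (\<forall>j<length ts. norm (ts'!j - ts!j) < \<delta>) \<and>
        (\<forall>j<length ks. norm (ks'!j - ks!j) < \<delta>) \<longrightarrow>
        norm (L ts' ks' - L ts ks
              - (\<Sum>j<length ts. p j * (ts'!j - ts!j)) - (\<Sum>j<length ks. q j * (ks'!j - ks!j)))
          \<le> \<epsilon> * ((\<Sum>j<length ts. norm (ts'!j - ts!j)) + (\<Sum>j<length ks. norm (ks'!j - ks!j))))"

definition dL_dtau ::
    "'a::real_normed_field lagrangian \<Rightarrow> nat \<Rightarrow> nat \<Rightarrow> (int \<Rightarrow> 'a) \<Rightarrow> (int \<Rightarrow> 'a) \<Rightarrow> nat \<Rightarrow> int \<Rightarrow> 'a"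
  where
  "dL_dtau L J1 J2 \<kappa> \<tau> j n =
     deriv (\<lambda>u. L ((window J1 \<tau> n)[j := u]) (window J2 \<kappa> n)) (\<tau> (n + int j))"

definition dL_dkappa ::
    "'a::real_normed_field lagrangian \<Rightarrow> nat \<Rightarrow> nat \<Rightarrow> (int \<Rightarrow> 'a) \<Rightarrow> (int \<Rightarrow> 'a) \<Rightarrow> nat \<Rightarrow> int \<Rightarrow> 'a"
  where
  "dL_dkappa L J1 J2 \<kappa> \<tau> j n =
     deriv (\<lambda>u. L (window J1 \<tau> n) ((window J2 \<kappa> n)[j := u])) (\<kappa> (n + int j))"

definition E_tau ::
    "'a::real_normed_field lagrangian \<Rightarrow> nat \<Rightarrow> nat \<Rightarrow> (int \<Rightarrow> 'a) \<Rightarrow> (int \<Rightarrow> 'a) \<Rightarrow> int \<Rightarrow> 'a"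
  where
  "E_tau L J1 J2 \<kappa> \<tau> n = (\<Sum>j\<le>J1. shift (- int j) (dL_dtau L J1 J2 \<kappa> \<tau> j) n)"

definition E_kappa ::
    "'a::real_normed_field lagrangian \<Rightarrow> nat \<Rightarrow> nat \<Rightarrow> (int \<Rightarrow> 'a) \<Rightarrow> (int \<Rightarrow> 'a) \<Rightarrow> int \<Rightarrow> 'a"
  where
  "E_kappa L J1 J2 \<kappa> \<tau> n = (\<Sum>j\<le>J2. shift (- int j) (dL_dkappa L J1 J2 \<kappa> \<tau> j) n)"

definition invariant_EL ::
    "'a::real_normed_field lagrangian \<Rightarrow> nat \<Rightarrow> nat \<Rightarrow> (int \<Rightarrow> 'a) \<Rightarrow> (int \<Rightarrow> 'a) \<Rightarrow> bool" where
  "invariant_EL L J1 J2 \<kappa> \<tau> \<longleftrightarrow>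
     (let Ek = E_kappa L J1 J2 \<kappa> \<tau>; Et = E_tau L J1 J2 \<kappa> \<tau> in
      \<forall>n. 0 = (\<kappa> n * Ek n - shift (-1) (\<lambda>m. \<kappa> m * Ek m) n)
              + (\<tau> n * Et n + shift (-1) (\<lambda>m. \<tau> m * Et m) n)
        \<and> 0 = - shift (-2) (\<lambda>m. \<tau> m / (\<tau> (m+1))^2 * Ek m) n
              + 1 / \<tau> n * Ek n
              + shift (-1) (\<lambda>m. \<kappa> m * Et m) n)"

text \<open>
  The Lagrangian in the original variables, and its difference Euler operator with respect
  to the component \<open>i\<close> of \<open>z\<close> (so \<open>i = 1\<close> for \<open>x\<close> and \<open>i = 2\<close> for \<open>y\<close>):
  the \<open>j\<close>-th term is the partial derivative of the summand at the site \<open>n - j\<close> with respect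
  to \<open>z n $ i\<close>.  The summand at the site \<open>m\<close> involves only the points of \<open>z\<close> at the sites
  \<open>m, ..., m + max (J1 + 1) (J2 + 2)\<close>.
\<close>

definition lagrangian_xy ::
    "'a::real_normed_field lagrangian \<Rightarrow> nat \<Rightarrow> nat \<Rightarrow> (int \<Rightarrow> 'a^2) \<Rightarrow> int \<Rightarrow> 'a" where
  "lagrangian_xy L J1 J2 z m = L (window J1 (tau_of z) m) (window J2 (kappa_of z) m)"

definition E_xy ::
    "'a::real_normed_field lagrangian \<Rightarrow> nat \<Rightarrow> nat \<Rightarrow> 2 \<Rightarrow> (int \<Rightarrow> 'a^2) \<Rightarrow> int \<Rightarrow> 'a" where
  "E_xy L J1 J2 i z n =
     (\<Sum>j\<le>max (J1 + 1) (J2 + 2).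
        deriv (\<lambda>u. lagrangian_xy L J1 J2 (z(n := \<chi> i'. if i' = i then u else z n $ i')) (n - int j))
              (z n $ i))"

definition solves_EL ::
    "'a::real_normed_field lagrangian \<Rightarrow> nat \<Rightarrow> nat \<Rightarrow> (int \<Rightarrow> 'a^2) \<Rightarrow> bool" where
  "solves_EL L J1 J2 z \<longleftrightarrow> (\<forall>n. E_xy L J1 J2 1 z n = 0 \<and> E_xy L J1 J2 2 z n = 0)"


definition V_inv ::
    "'a::real_normed_field lagrangian \<Rightarrow> nat \<Rightarrow> nat \<Rightarrow> (int \<Rightarrow> 'a) \<Rightarrow> (int \<Rightarrow> 'a) \<Rightarrow> int \<Rightarrow> 'a^3"
  where
  "V_inv L J1 J2 \<kappa> \<tau> n =
     (let Ek = E_kappa L J1 J2 \<kappa> \<tau>; Et = E_tau L J1 J2 \<kappa> \<tau>;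
          Cx0 = - shift (-1) (\<lambda>m. \<kappa> m * Ek m) n + shift (-1) (\<lambda>m. \<tau> m * Et m) n;
          Cy0 = shift (-1) (\<lambda>m. \<kappa> m * Et m) n
                - shift (-2) (\<lambda>m. \<tau> m / (\<tau> (m+1))^2 * Ek m) n;
          Cy1 = - shift (-1) (\<lambda>m. \<tau> m / (\<tau> (m+1))^2 * Ek m) n
      in Cx0 *s vector [1, 0, 0] + Cy0 *s vector [0, 0, 1]
         + Cy1 *s (vector [0, 0, 1] v* Ad (K_mat (\<kappa> n) (\<tau> n))))"


text \<open>
  The closed formula, over the complex numbers; \<open>s\<close> is the chosen square root of
  \<open>k\<^sub>1\<^sup>2 + 4 k\<^sub>2 k\<^sub>3\<close>, and \<open>k\<close>, \<open>V\<close>, \<open>\<tau>\<close>, \<open>c0\<close>, \<open>d0\<close> are complex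
  (for real data they are the images under the inclusion of the reals).
\<close>

definition Q_mat :: "complex \<Rightarrow> complex^3 \<Rightarrow> complex^2^2" where
  "Q_mat s k = mat2 (k$1 - s) (k$1 + s) (2 * k$3) (2 * k$3)"

definition zeta :: "(int \<Rightarrow> complex^3) \<Rightarrow> (int \<Rightarrow> complex) \<Rightarrow> int \<Rightarrow> complex" where
  "zeta V \<tau> l = - (\<tau> l / (2 * V l $ 2))"

definition explicit_formula ::
    "complex \<Rightarrow> complex^3 \<Rightarrow> (int \<Rightarrow> complex^3) \<Rightarrow> (int \<Rightarrow> complex) \<Rightarrow> complex \<Rightarrow> complex \<Rightarrow> nat \<Rightarrow> complex^2"
  where
  "explicit_formula s k V \<tau> c0 d0 n =
     (mat2 0 1 (-1) 0 ** Q_mat s k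
      ** mat2 (\<Prod>l<n. zeta V \<tau> (int l) * (V (int l) $ 1 - s)) 0
              0 (\<Prod>l<n. zeta V \<tau> (int l) * (V (int l) $ 1 + s))
      ** matrix_inv (Q_mat s k)) *v vector [c0, d0]"

definition map_vec :: "('a \<Rightarrow> 'b) \<Rightarrow> 'a^'n \<Rightarrow> 'b^'n" where
  "map_vec f v = (\<chi> i. f (v $ i))"

end

theory Submission
  imports Defs
begin

text \<open>
  Write \<open>\<rho>\<^sub>n\<close> for the frame with rows \<open>(a\<^sub>n, b\<^sub>n)\<close> and \<open>(c\<^sub>n, d\<^sub>n) = (- y\<^sub>n, x\<^sub>n)\<close>, and
  \<open>V\<^sub>n\<close> for the invariant vector of the conservation laws.

  The proof rests on the linear recursion \<open>\<rho>\<^sub>n\<^sub>+\<^sub>1 = K\<^sub>n \<rho>\<^sub>n\<close> (\<open>frame_step\<close>), a restatement of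
  the linear dependence of three plane vectors.  As \<open>K\<^sub>n\<close> is invertible and depends only on
  \<open>\<kappa>\<^sub>n\<close> and \<open>\<tau>\<^sub>n\<close>, a sequence is determined by its invariants and one frame, and every
  initial frame of determinant one occurs (\<open>sequence_from_frame\<close>).

  The invariant Euler-Lagrange equations say \<open>V\<^sub>n\<^sub>+\<^sub>1 Ad(K\<^sub>n) = V\<^sub>n\<close> (\<open>V_inv_step\<close>).  Since \<open>Ad\<close>
  is multiplicative, \<open>V\<^sub>n Ad(\<rho>\<^sub>n)\<close> is then a constant \<open>k\<close>.  This constancy, with
  \<open>det \<rho>\<^sub>n = 1\<close>, lets one solve linearly for the first row of \<open>\<rho>\<^sub>n\<close> in terms of the second
  (\<open>frame_linear_recursion\<close>), and the frame recursion becomes a two-dimensional recursion for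
  \<open>(c\<^sub>n, d\<^sub>n)\<close> alone.  Its coefficient matrices depend on \<open>n\<close> only through a scalar
  factor and a scalar summand, so they have common eigenvectors, the columns of \<open>Q\<close>, and the
  closed formula follows (\<open>explicit_formula_of_recursion\<close>).

  That the sequences so constructed solve the Euler-Lagrange equations in \<open>(x, y)\<close> is the
  change of variables in the variation: varying one point of the sequence and applying the chain
  rule gives the Euler operators in \<open>(x, y)\<close> as linear combinations of the two invariant
  equations (\<open>E_xy_invariant\<close>).
\<close>

section \<open>Matrices and sequences over the integers\<close>

lemma mat2_nth [simp]:
  "mat2 a b c d $ 1 $ 1 = a" "mat2 a b c d $ 1 $ 2 = b"
  "mat2 a b c d $ 2 $ 1 = c" "mat2 a b c d $ 2 $ 2 = d"
  by (simp_all add: mat2_def)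

lemma matrix_2_eq_iff:
  "A = B \<longleftrightarrow> A$1$1 = B$1$1 \<and> A$1$2 = B$1$2 \<and> A$2$1 = B$2$1 \<and> A$2$2 = B$2$2"
  for A B :: "'a^2^2"
  by (auto simp: vec_eq_iff forall_2)

lemma matrix_mult_2_nth:
  "(A ** B) $ i $ j = A$i$1 * B$1$j + A$i$2 * B$2$j"
  for A B :: "'a::semiring_1^2^2"
  by (simp add: matrix_matrix_mult_def sum_2)

lemma Ad_nth:
  "Ad g $ 1 $ 1 = g$1$1 * g$2$2 + g$1$2 * g$2$1"
  "Ad g $ 1 $ 2 = - (g$1$1 * g$2$1)"
  "Ad g $ 1 $ 3 = g$1$2 * g$2$2"
  "Ad g $ 2 $ 1 = - (2 * g$1$1 * g$1$2)"
  "Ad g $ 2 $ 2 = (g$1$1)^2"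
  "Ad g $ 2 $ 3 = - ((g$1$2)^2)"
  "Ad g $ 3 $ 1 = 2 * g$2$1 * g$2$2"
  "Ad g $ 3 $ 2 = - ((g$2$1)^2)"
  "Ad g $ 3 $ 3 = (g$2$2)^2"
  by (simp_all add: Ad_def Let_def)

text \<open>
  \<open>Ad\<close> is the symmetric square in disguise: with row vectors written in the basis
  \<open>- u v\<close>, \<open>u\<^sup>2\<close>, \<open>- v\<^sup>2\<close> of the quadratic forms, \<open>Ad g\<close> is the substitution
  \<open>u \<mapsto> a u + b v\<close>, \<open>v \<mapsto> c u + d v\<close>.  Hence it is multiplicative on all matrices.
\<close>

lemma Ad_mult: "Ad (g ** h) = Ad g ** Ad h"
  by (simp add: vec_eq_iff forall_3 Ad_nth matrix_matrix_mult_def sum_2 sum_3)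
     (simp add: algebra_simps power2_eq_square)

lemma vector_mult_Ad_nth:
  fixes v :: "'a::real_normed_field^3"
  shows "(v v* Ad g) $ j = v$1 * Ad g $ 1 $ j + v$2 * Ad g $ 2 $ j + v$3 * Ad g $ 3 $ j"
  by (simp add: vector_matrix_mult_def sum_3 mult.commute)

lemma int_seq_const:
  fixes f :: "int \<Rightarrow> 'b"
  assumes "\<And>n. f (n + 1) = f n"
  shows "f n = f 0"
proof (induction n rule: int_induct[of _ 0])
  case (step1 i) then show ?case using assms by simp
next
  case (step2 i) then show ?case using assms[of "i - 1"] by simp
qed simp

text \<open>
  A recursion over the integers has to be run in both directions from its initial value;
  surjectivity supplies the backward steps.
\<close>

lemma int_recursion_exists:
  fixes F :: "int \<Rightarrow> 'b \<Rightarrow> 'b"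
  assumes surj: "\<And>n. surj (F n)"
  shows "\<exists>X. X 0 = x0 \<and> (\<forall>n. X (n + 1) = F n (X n))"
proof -
  define P where "P = rec_nat x0 (\<lambda>m. F (int m))"
  define N where "N = rec_nat x0 (\<lambda>m y. inv (F (- int m - 1)) y)"
  define X where "X n = (if n \<ge> 0 then P (nat n) else N (nat (- n)))" for n
  have "X (n + 1) = F n (X n)" for n
  proof (cases "n \<ge> 0")
    case True
    then show ?thesis by (simp add: X_def P_def nat_add_distrib)
  next
    case False
    define m where "m = nat (- n - 1)"
    have n: "n = - int m - 1" using False by (simp add: m_def)
    have "X (n + 1) = N m"
      by (cases "m = 0") (simp_all add: X_def n N_def P_def)
    moreover have "X n = inv (F n) (N m)"
    proof -
      have "nat (- n) = Suc m" "\<not> n \<ge> 0" using n by simp_all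
      then show ?thesis by (simp add: X_def N_def n)
    qed
    ultimately show ?thesis by (simp add: surj_f_inv_f[OF surj])
  qed
  moreover have "X 0 = x0" by (simp add: X_def P_def)
  ultimately show ?thesis by blast
qed

lemma int_recursion_unique:
  fixes F :: "int \<Rightarrow> 'b \<Rightarrow> 'b"
  assumes inj: "\<And>n. inj (F n)"
    and X: "\<And>n. X (n + 1) = F n (X n)" and Y: "\<And>n. Y (n + 1) = F n (Y n)"
    and "X 0 = Y 0"
  shows "X = Y"
proof
  fix n
  have "(X (n + 1) = Y (n + 1)) = (X n = Y n)" for n
    using X[of n] Y[of n] inj_eq[OF inj] by simp
  from int_seq_const[of "\<lambda>n. X n = Y n", OF this] show "X n = Y n"
    using assms(4) by simp
qed

section \<open>The frame and the generating invariants\<close>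

lemma K_mat_nth [simp]:
  "K_mat k t $ 1 $ 1 = k" "K_mat k t $ 1 $ 2 = 1 / t"
  "K_mat k t $ 2 $ 1 = - t" "K_mat k t $ 2 $ 2 = 0"
  by (simp_all add: K_mat_def)

lemma K_mat_bij:
  fixes k t :: "'a::real_normed_field"
  assumes "t \<noteq> 0"
  shows "bij (\<lambda>g. K_mat k t ** g)"
proof (rule bij_betw_byWitness[where f' = "\<lambda>g. mat2 0 (- 1 / t) t k ** g"])
  have "mat2 0 (- 1 / t) t k ** K_mat k t = mat 1" "K_mat k t ** mat2 0 (- 1 / t) t k = mat 1"
    using assms by (simp_all add: matrix_2_eq_iff matrix_mult_2_nth mat_def)
  then show "\<forall>g\<in>UNIV. mat2 0 (- 1 / t) t k ** (K_mat k t ** g) = g"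
    "\<forall>g\<in>UNIV. K_mat k t ** (mat2 0 (- 1 / t) t k ** g) = g"
    by (simp_all add: matrix_mul_assoc)
qed auto

lemma frame_nth [simp]:
  "frame z n $ 1 $ 1 = z (n+1) $ 2 / tau_of z n"
  "frame z n $ 1 $ 2 = - z (n+1) $ 1 / tau_of z n"
  "frame z n $ 2 $ 1 = - z n $ 2"
  "frame z n $ 2 $ 2 = z n $ 1"
  by (simp_all add: frame_def)

lemma frame_eq_imp_eq:
  assumes "frame z = frame z'"
  shows "z = z'"
proof
  fix n
  have "frame z n $ 2 $ 1 = frame z' n $ 2 $ 1" "frame z n $ 2 $ 2 = frame z' n $ 2 $ 2"
    using assms by simp_all
  then show "z n = z' n" by (simp add: vec_eq_iff forall_2)
qed

text \<open>
  Any three plane vectors satisfy \<open>[z0, z1] z2 - [z0, z2] z1 + [z1, z2] z0 = 0\<close>, where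
  \<open>[v, w]\<close> is the determinant with columns \<open>v\<close> and \<open>w\<close>.  For consecutive points the three
  determinants are \<open>\<tau>\<^sub>0\<close>, \<open>\<kappa>\<^sub>0 \<tau>\<^sub>1\<close> and \<open>\<tau>\<^sub>1\<close>.
\<close>

lemma three_term_recurrence:
  assumes "tau_of z n \<noteq> 0" "tau_of z (n+1) \<noteq> 0"
  shows "z (n+2) $ i / tau_of z (n+1) = (kappa_of z n * z (n+1) $ i - z n $ i) / tau_of z n"
proof -
  define w where "w = kappa_of z n * tau_of z (n+1)"
  have w: "w = z n $ 1 * z (n+2) $ 2 - z (n+2) $ 1 * z n $ 2"
    using assms by (simp add: w_def kappa_of_def tau_of_def add.assoc)
  have "tau_of z n * z (n+2) $ i = w * z (n+1) $ i - tau_of z (n+1) * z n $ i"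
    using exhaust_2[of i] by (auto simp: w tau_of_def algebra_simps add.assoc)
  then show ?thesis using assms by (simp add: w_def field_simps)
qed

lemma frame_step:
  assumes "tau_of z n \<noteq> 0" "tau_of z (n+1) \<noteq> 0"
  shows "frame z (n+1) = K_mat (kappa_of z n) (tau_of z n) ** frame z n"
  using assms three_term_recurrence[OF assms, of 1] three_term_recurrence[OF assms, of 2]
  by (simp add: matrix_2_eq_iff matrix_mult_2_nth add.assoc diff_divide_distrib)

lemma det_frame:
  assumes "tau_of z n \<noteq> 0"
  shows "det (frame z n) = 1"
proof -
  have "det (frame z n) = (z n $ 1 * z (n+1) $ 2 - z (n+1) $ 1 * z n $ 2) / tau_of z n"
    by (simp add: det_2 diff_divide_distrib mult.commute)
  then show ?thesis using assms by (simp add: tau_of_def)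
qed

text \<open>
  Conversely to \<open>frame_step\<close>, every solution of the frame recursion with determinant one at
  \<open>0\<close> is the frame of a sequence with the prescribed invariants.  The second row of a frame
  is \<open>(- y, x)\<close>, which dictates the sequence; the determinant stays one because
  \<open>K_mat \<kappa> \<tau>\<close> has determinant one, and it is what makes the determinants of neighbouring
  points come out as \<open>\<tau>\<close> and \<open>\<kappa> \<tau>\<^sub>1\<close>.
\<close>

lemma sequence_from_frame:
  fixes \<kappa> \<tau> :: "int \<Rightarrow> 'a::real_normed_field" and \<rho> :: "int \<Rightarrow> 'a^2^2"
  assumes \<tau>: "\<And>n. \<tau> n \<noteq> 0"
    and step: "\<And>n. \<rho> (n+1) = K_mat (\<kappa> n) (\<tau> n) ** \<rho> n"
    and det0: "det (\<rho> 0) = 1"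
  obtains z where "tau_of z = \<tau>" "kappa_of z = \<kappa>" "frame z = \<rho>"
proof
  define z :: "int \<Rightarrow> 'a^2" where "z n = vector [\<rho> n $ 2 $ 2, - \<rho> n $ 2 $ 1]" for n
  have z: "z n $ 1 = \<rho> n $ 2 $ 2" "z n $ 2 = - \<rho> n $ 2 $ 1" for n
    by (simp_all add: z_def)
  have next2: "\<rho> (n+1) $ 2 $ 1 = - \<tau> n * \<rho> n $ 1 $ 1" "\<rho> (n+1) $ 2 $ 2 = - \<tau> n * \<rho> n $ 1 $ 2" for n
    by (simp_all add: step matrix_mult_2_nth)
  have next1: "\<rho> (n+1) $ 1 $ j = \<kappa> n * \<rho> n $ 1 $ j + \<rho> n $ 2 $ j / \<tau> n" for n j
    by (simp add: step matrix_mult_2_nth)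
  have "det (\<rho> (n+1)) = det (\<rho> n)" for n
    using \<tau>[of n] by (simp add: step det_mul) (simp add: det_2)
  then have "det (\<rho> n) = 1" for n
    using int_seq_const[of "\<lambda>n. det (\<rho> n)" n] det0 by simp
  then have det1: "\<rho> n $ 1 $ 1 * \<rho> n $ 2 $ 2 = 1 + \<rho> n $ 1 $ 2 * \<rho> n $ 2 $ 1" for n
    by (simp add: det_2 algebra_simps)
  have tau: "tau_of z n = \<tau> n" for n
  proof -
    have "tau_of z n = \<tau> n * (\<rho> n $ 1 $ 1 * \<rho> n $ 2 $ 2 - \<rho> n $ 1 $ 2 * \<rho> n $ 2 $ 1)"
      unfolding tau_of_def z next2 by (simp add: algebra_simps)
    then show ?thesis using det1[of n] by simp
  qed
  then show "tau_of z = \<tau>" by blast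
  have "kappa_of z n = \<kappa> n" for n
  proof -
    have next_next: "\<rho> (n+2) $ 2 $ 1 = - \<tau> (n+1) * (\<kappa> n * \<rho> n $ 1 $ 1 + \<rho> n $ 2 $ 1 / \<tau> n)"
      "\<rho> (n+2) $ 2 $ 2 = - \<tau> (n+1) * (\<kappa> n * \<rho> n $ 1 $ 2 + \<rho> n $ 2 $ 2 / \<tau> n)"
      using next2[of "n+1"] by (simp_all add: next1 add.assoc)
    have "z n $ 1 * z (n+2) $ 2 - z (n+2) $ 1 * z n $ 2
        = \<tau> (n+1) * \<kappa> n * (\<rho> n $ 1 $ 1 * \<rho> n $ 2 $ 2 - \<rho> n $ 1 $ 2 * \<rho> n $ 2 $ 1)"
      \<comment> \<open>the terms coming from the second row of \<open>\<rho> n\<close> cancel by antisymmetry\<close>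
      unfolding z next_next by (simp add: algebra_simps)
    also have "\<dots> = \<tau> (n+1) * \<kappa> n" using det1[of n] by simp
    finally show ?thesis
      using tau[of "n+1"] \<tau>[of "n+1"] by (simp add: kappa_of_def tau_of_def add.assoc)
  qed
  then show "kappa_of z = \<kappa>" by blast
  show "frame z = \<rho>"
    using \<tau> by (simp add: fun_eq_iff matrix_2_eq_iff tau z next2)
qed

section \<open>The conservation laws\<close>

text \<open>
  The third row of \<open>Ad (K_mat \<kappa> \<tau>)\<close> is \<open>(0, - \<tau>\<^sup>2, 0)\<close>, so the three terms of \<open>V_inv\<close>
  fill one component each.
\<close>

lemma V_inv_nth:
  fixes L :: "'a::real_normed_field lagrangian" and J1 J2 :: nat and \<kappa> \<tau> :: "int \<Rightarrow> 'a"
  defines "Ek \<equiv> E_kappa L J1 J2 \<kappa> \<tau>" and "Et \<equiv> E_tau L J1 J2 \<kappa> \<tau>"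
  assumes "\<tau> n \<noteq> 0"
  shows "V_inv L J1 J2 \<kappa> \<tau> n $ 1 = \<tau> (n-1) * Et (n-1) - \<kappa> (n-1) * Ek (n-1)"
    and "V_inv L J1 J2 \<kappa> \<tau> n $ 2 = \<tau> (n-1) * Ek (n-1)"
    and "V_inv L J1 J2 \<kappa> \<tau> n $ 3 = \<kappa> (n-1) * Et (n-1) - \<tau> (n-2) / (\<tau> (n-1))^2 * Ek (n-2)"
  using assms by (simp_all add: V_inv_def Let_def shift_def vector_mult_Ad_nth Ad_nth)

lemma invariant_EL_eqs:
  fixes L :: "'a::real_normed_field lagrangian" and J1 J2 :: nat and \<kappa> \<tau> :: "int \<Rightarrow> 'a"
  defines "Ek \<equiv> E_kappa L J1 J2 \<kappa> \<tau>" and "Et \<equiv> E_tau L J1 J2 \<kappa> \<tau>"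
  assumes "invariant_EL L J1 J2 \<kappa> \<tau>"
  shows "\<kappa> n * Ek n - \<kappa> (n-1) * Ek (n-1) + \<tau> n * Et n + \<tau> (n-1) * Et (n-1) = 0"
    and "Ek n / \<tau> n + \<kappa> (n-1) * Et (n-1) - \<tau> (n-2) / (\<tau> (n-1))^2 * Ek (n-2) = 0"
proof -
  have "0 = (\<kappa> n * Ek n - \<kappa> (n-1) * Ek (n-1)) + (\<tau> n * Et n + \<tau> (n-1) * Et (n-1))"
    and "0 = - (\<tau> (n-2) / (\<tau> (n-1))^2 * Ek (n-2)) + 1 / \<tau> n * Ek n + \<kappa> (n-1) * Et (n-1)"
    using assms(3) unfolding invariant_EL_def Let_def shift_def Ek_def Et_def
    by (simp_all del: add_uminus_conv_diff add: diff_conv_add_uminus[symmetric])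
  then show "\<kappa> n * Ek n - \<kappa> (n-1) * Ek (n-1) + \<tau> n * Et n + \<tau> (n-1) * Et (n-1) = 0"
    "Ek n / \<tau> n + \<kappa> (n-1) * Et (n-1) - \<tau> (n-2) / (\<tau> (n-1))^2 * Ek (n-2) = 0"
    by (simp_all add: algebra_simps)
qed

text \<open>
  The conservation law in invariant form.  Comparing components, the first one is the first
  invariant Euler-Lagrange equation at \<open>n\<close>, the third one is the second equation at \<open>n\<close>, and
  the second one is an identity.
\<close>

lemma V_inv_step:
  fixes L :: "'a::real_normed_field lagrangian"
  assumes \<tau>: "\<And>n. \<tau> n \<noteq> 0" and EL: "invariant_EL L J1 J2 \<kappa> \<tau>"
  shows "V_inv L J1 J2 \<kappa> \<tau> (n+1) v* Ad (K_mat (\<kappa> n) (\<tau> n)) = V_inv L J1 J2 \<kappa> \<tau> n"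
proof -
  define Ek where "Ek = E_kappa L J1 J2 \<kappa> \<tau>"
  define Et where "Et = E_tau L J1 J2 \<kappa> \<tau>"
  note V = V_inv_nth[where L = L and ?J1.0 = J1 and ?J2.0 = J2 and \<kappa> = \<kappa> and \<tau> = \<tau>,
      OF \<tau>, folded Ek_def Et_def]
  note e = invariant_EL_eqs[OF EL, folded Ek_def Et_def, of n]
  have e2: "\<kappa> (n-1) * Et (n-1) - \<tau> (n-2) / (\<tau> (n-1))^2 * Ek (n-2) = - Ek n / \<tau> n"
    using e(2) by (simp add: algebra_simps)
  have e1: "\<tau> (n-1) * Et (n-1) - \<kappa> (n-1) * Ek (n-1) = - (\<kappa> n * Ek n) - \<tau> n * Et n"
    using e(1) by (simp add: algebra_simps)
  show ?thesis unfolding vec_eq_iff forall_3 vector_mult_Ad_nth V Ad_nth e1 e2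
    using \<tau>[of n] by (simp add: field_simps power2_eq_square)
qed

lemma conservation_law:
  fixes L :: "'a::real_normed_field lagrangian"
  assumes \<tau>: "\<And>n. \<tau> n \<noteq> 0" and EL: "invariant_EL L J1 J2 \<kappa> \<tau>"
    and z: "kappa_of z = \<kappa>" "tau_of z = \<tau>"
  shows "V_inv L J1 J2 \<kappa> \<tau> n v* Ad (frame z n) = V_inv L J1 J2 \<kappa> \<tau> 0 v* Ad (frame z 0)"
proof (rule int_seq_const)
  fix n
  show "V_inv L J1 J2 \<kappa> \<tau> (n+1) v* Ad (frame z (n+1)) = V_inv L J1 J2 \<kappa> \<tau> n v* Ad (frame z n)"
    using frame_step[of z n] \<tau>
    by (simp add: z Ad_mult vector_matrix_mul_assoc[symmetric] V_inv_step[OF \<tau> EL])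
qed

section \<open>Chain rule for the Lagrangian\<close>

text \<open>
  The chain rule for a function of finitely many scalar variables, given only as the composite
  \<open>F\<close> along the curves \<open>f i\<close>.  The outer function is differentiable at one point in the
  \<open>\<epsilon>\<close>-\<open>\<delta>\<close> sense, with partial derivatives \<open>p i\<close>.  The error \<open>R\<close> of its linear
  approximation is at most \<open>\<epsilon>\<close> times the total increment of the curves, and the difference
  quotients \<open>S\<close> of that increment stay bounded, so \<open>R\<close> has derivative zero.
\<close>

lemma chain_rule_from_linear_approximation:
  fixes F :: "'a::real_normed_field \<Rightarrow> 'a" and f :: "'b \<Rightarrow> 'a \<Rightarrow> 'a" and p f' :: "'b \<Rightarrow> 'a"
  assumes fin: "finite I"
    and f: "\<And>i. i \<in> I \<Longrightarrow> (f i has_field_derivative f' i) (at u)"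
    and approx: "\<And>\<epsilon>. \<epsilon> > 0 \<Longrightarrow> \<exists>\<delta>>0. \<forall>v. (\<forall>i\<in>I. norm (f i v - f i u) < \<delta>) \<longrightarrow>
        norm (F v - F u - (\<Sum>i\<in>I. p i * (f i v - f i u))) \<le> \<epsilon> * (\<Sum>i\<in>I. norm (f i v - f i u))"
  shows "(F has_field_derivative (\<Sum>i\<in>I. p i * f' i)) (at u)"
proof -
  define R where "R v = F v - F u - (\<Sum>i\<in>I. p i * (f i v - f i u))" for v
  define S where "S v = (\<Sum>i\<in>I. norm ((f i v - f i u) / (v - u)))" for v
  define C where "C = (\<Sum>i\<in>I. norm (f' i))"
  have "(S \<longlongrightarrow> C) (at u)"
    unfolding S_def C_def using f
    by (intro tendsto_sum tendsto_norm) (simp add: has_field_derivative_iff)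
  then have S_bound: "eventually (\<lambda>v. S v < C + 1) (at u)"
    by (rule order_tendstoD) simp
  have C: "C \<ge> 0" by (simp add: C_def sum_nonneg)
  have "((\<lambda>v. R v / (v - u)) \<longlongrightarrow> 0) (at u)"
  proof (rule tendstoI)
    fix e :: real assume e: "e > 0"
    define \<epsilon> where "\<epsilon> = e / (C + 1)"
    have \<epsilon>: "\<epsilon> > 0" using e C by (simp add: \<epsilon>_def)
    from approx[OF this] obtain \<delta> where \<delta>: "\<delta> > 0"
      and R: "\<And>v. \<forall>i\<in>I. norm (f i v - f i u) < \<delta> \<Longrightarrow> norm (R v) \<le> \<epsilon> * (\<Sum>i\<in>I. norm (f i v - f i u))"
      unfolding R_def by blast
    have "\<forall>i\<in>I. eventually (\<lambda>v. norm (f i v - f i u) < \<delta>) (at u)"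
    proof
      fix i assume "i \<in> I"
      then have "(f i \<longlongrightarrow> f i u) (at u)"
        using DERIV_isCont[OF f] by (simp add: isCont_def)
      then show "eventually (\<lambda>v. norm (f i v - f i u) < \<delta>) (at u)"
        using \<delta> by (auto simp: tendsto_iff dist_norm)
    qed
    then have "eventually (\<lambda>v. \<forall>i\<in>I. norm (f i v - f i u) < \<delta>) (at u)"
      using fin by (simp add: eventually_ball_finite)
    then show "eventually (\<lambda>v. dist (R v / (v - u)) 0 < e) (at u)"
      using S_bound
    proof eventually_elim
      case (elim v)
      have "norm (R v / (v - u)) \<le> \<epsilon> * (\<Sum>i\<in>I. norm (f i v - f i u)) / norm (v - u)"
        using R[OF elim(1)] by (simp add: norm_divide divide_right_mono)
      also have "\<dots> = \<epsilon> * S v"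
        by (simp add: S_def norm_divide flip: sum_divide_distrib)
      also have "\<dots> < \<epsilon> * (C + 1)" using elim(2) \<epsilon> by simp
      also have "\<dots> = e" using C by (simp add: \<epsilon>_def)
      finally show ?case by simp
    qed
  qed
  then have "(R has_field_derivative 0) (at u)"
    by (simp add: has_field_derivative_iff R_def)
  moreover have "((\<lambda>v. F u + (\<Sum>i\<in>I. p i * (f i v - f i u))) has_field_derivative (\<Sum>i\<in>I. p i * f' i)) (at u)"
    by (auto intro!: derivative_eq_intros f sum.cong)
  ultimately have "((\<lambda>v. R v + (F u + (\<Sum>i\<in>I. p i * (f i v - f i u)))) has_field_derivative
      0 + (\<Sum>i\<in>I. p i * f' i)) (at u)"
    by (rule DERIV_add)
  then show ?thesis by (simp add: R_def)
qed

lemma lagrangian_chain_rule: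
  assumes "lagrangian_differentiable_at L ts ks"
  obtains p q where
    "\<And>f g f' g' u.
       (\<And>j. j < length ts \<Longrightarrow> f j u = ts!j \<and> (f j has_field_derivative f' j) (at u)) \<Longrightarrow>
       (\<And>j. j < length ks \<Longrightarrow> g j u = ks!j \<and> (g j has_field_derivative g' j) (at u)) \<Longrightarrow>
       ((\<lambda>v. L (map (\<lambda>j. f j v) [0..<length ts]) (map (\<lambda>j. g j v) [0..<length ks]))
          has_field_derivative (\<Sum>j<length ts. p j * f' j) + (\<Sum>j<length ks. q j * g' j)) (at u)"
proof -
  obtain p q where pq: "\<forall>\<epsilon>>0. \<exists>\<delta>>0. \<forall>ts' ks'.
        length ts' = length ts \<and> length ks' = length ks \<and>
        (\<forall>j<length ts. norm (ts'!j - ts!j) < \<delta>) \<and>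
        (\<forall>j<length ks. norm (ks'!j - ks!j) < \<delta>) \<longrightarrow>
        norm (L ts' ks' - L ts ks
              - (\<Sum>j<length ts. p j * (ts'!j - ts!j)) - (\<Sum>j<length ks. q j * (ks'!j - ks!j)))
          \<le> \<epsilon> * ((\<Sum>j<length ts. norm (ts'!j - ts!j)) + (\<Sum>j<length ks. norm (ks'!j - ks!j)))"
    using assms unfolding lagrangian_differentiable_at_def by blast
  show thesis
  proof (rule that)
    fix f g f' g' u
    assume f: "\<And>j. j < length ts \<Longrightarrow> f j u = ts!j \<and> (f j has_field_derivative f' j) (at u)"
      and g: "\<And>j. j < length ks \<Longrightarrow> g j u = ks!j \<and> (g j has_field_derivative g' j) (at u)"
    \<comment> \<open>both argument lists together form one family of scalar variables\<close>
    define I :: "(nat + nat) set" where "I = {..<length ts} <+> {..<length ks}"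
    have sum_I: "(\<Sum>i\<in>I. h i) = (\<Sum>j<length ts. h (Inl j)) + (\<Sum>j<length ks. h (Inr j))"
      for h :: "nat + nat \<Rightarrow> 'c::comm_monoid_add"
      by (simp add: I_def sum.Plus)
    have ball_I: "(\<forall>i\<in>I. P i) \<longleftrightarrow> (\<forall>j<length ts. P (Inl j)) \<and> (\<forall>j<length ks. P (Inr j))" for P
      by (auto simp: I_def)
    define F where "F v = L (map (\<lambda>j. f j v) [0..<length ts]) (map (\<lambda>j. g j v) [0..<length ks])" for v
    have at_u: "map (\<lambda>j. f j u) [0..<length ts] = ts" "map (\<lambda>j. g j u) [0..<length ks] = ks"
      using f g by (auto intro!: nth_equalityI)
    have "(F has_field_derivative (\<Sum>i\<in>I. case_sum p q i * case_sum f' g' i)) (at u)"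
    proof (rule chain_rule_from_linear_approximation[where f = "case_sum f g"])
      show "finite I" by (simp add: I_def)
      show "(case_sum f g i has_field_derivative case_sum f' g' i) (at u)" if "i \<in> I" for i
        using that f g by (auto simp: I_def)
    next
      fix \<epsilon> :: real assume "\<epsilon> > 0"
      with pq obtain \<delta> where \<delta>: "\<delta> > 0" and *: "\<And>ts' ks'.
        length ts' = length ts \<and> length ks' = length ks \<and>
        (\<forall>j<length ts. norm (ts'!j - ts!j) < \<delta>) \<and>
        (\<forall>j<length ks. norm (ks'!j - ks!j) < \<delta>) \<longrightarrow>
        norm (L ts' ks' - L ts ks
              - (\<Sum>j<length ts. p j * (ts'!j - ts!j)) - (\<Sum>j<length ks. q j * (ks'!j - ks!j)))
          \<le> \<epsilon> * ((\<Sum>j<length ts. norm (ts'!j - ts!j)) + (\<Sum>j<length ks. norm (ks'!j - ks!j)))"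
        by meson
      have "norm (F v - F u - (\<Sum>i\<in>I. case_sum p q i * (case_sum f g i v - case_sum f g i u)))
          \<le> \<epsilon> * (\<Sum>i\<in>I. norm (case_sum f g i v - case_sum f g i u))"
        if "\<forall>i\<in>I. norm (case_sum f g i v - case_sum f g i u) < \<delta>" for v
        using *[of "map (\<lambda>j. f j v) [0..<length ts]" "map (\<lambda>j. g j v) [0..<length ks]"] that f g
        by (simp add: sum_I ball_I F_def at_u diff_diff_eq add.assoc)
      with \<delta> show "\<exists>\<delta>>0. \<forall>v. (\<forall>i\<in>I. norm (case_sum f g i v - case_sum f g i u) < \<delta>) \<longrightarrow>
        norm (F v - F u - (\<Sum>i\<in>I. case_sum p q i * (case_sum f g i v - case_sum f g i u)))
          \<le> \<epsilon> * (\<Sum>i\<in>I. norm (case_sum f g i v - case_sum f g i u))"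
        by blast
    qed
    then show "((\<lambda>v. L (map (\<lambda>j. f j v) [0..<length ts]) (map (\<lambda>j. g j v) [0..<length ks]))
          has_field_derivative (\<Sum>j<length ts. p j * f' j) + (\<Sum>j<length ks. q j * g' j)) (at u)"
      by (simp add: F_def[abs_def] sum_I)
  qed
qed

lemma length_window [simp]: "length (window J f n) = Suc J"
  by (simp add: window_def del: upt_Suc)

lemma window_nth [simp]: "j \<le> J \<Longrightarrow> window J f n ! j = f (n + int j)"
  by (simp add: window_def del: upt_Suc)

lemma window_update:
  "(window J f n)[i := u] = map (\<lambda>j. if j = i then u else f (n + int j)) [0..<Suc J]"
  by (rule nth_equalityI) (auto simp: nth_list_update simp del: upt_Suc)

text \<open>
  The coefficients of the linear approximation are identified with the partial derivatives
  by applying the chain rule to curves that move a single list entry.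
\<close>

lemma window_chain_rule:
  fixes L :: "'a::real_normed_field lagrangian" and T K :: "'a \<Rightarrow> int \<Rightarrow> 'a"
  assumes L: "lagrangian_differentiable_at L (window J1 \<tau> n) (window J2 \<kappa> n)"
    and T: "T u = \<tau>" "\<And>m. ((\<lambda>v. T v m) has_field_derivative T' m) (at u)"
    and K: "K u = \<kappa>" "\<And>m. ((\<lambda>v. K v m) has_field_derivative K' m) (at u)"
  shows "((\<lambda>v. L (window J1 (T v) n) (window J2 (K v) n)) has_field_derivative
      (\<Sum>j\<le>J1. dL_dtau L J1 J2 \<kappa> \<tau> j n * T' (n + int j))
      + (\<Sum>j\<le>J2. dL_dkappa L J1 J2 \<kappa> \<tau> j n * K' (n + int j))) (at u)"
proof (rule lagrangian_chain_rule[OF L], goal_cases)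
  case (1 p q)
  note chain = 1[unfolded length_window less_Suc_eq_le lessThan_Suc_atMost]
  have p: "dL_dtau L J1 J2 \<kappa> \<tau> i n = p i" if "i \<le> J1" for i
  proof -
    have "((\<lambda>v. L ((window J1 \<tau> n)[i := v]) (window J2 \<kappa> n)) has_field_derivative
       (\<Sum>j\<le>J1. p j * (if j = i then 1 else 0)) + (\<Sum>j\<le>J2. q j * 0)) (at (\<tau> (n + int i)))"
      unfolding window_update window_def[of J2] by (rule chain) auto
    then show ?thesis
      using that unfolding dL_dtau_def
      by (auto intro!: DERIV_imp_deriv simp: if_distrib[of "\<lambda>x. _ * x"] sum.delta cong: if_cong)
  qed
  have q: "dL_dkappa L J1 J2 \<kappa> \<tau> i n = q i" if "i \<le> J2" for i
  proof -
    have "((\<lambda>v. L (window J1 \<tau> n) ((window J2 \<kappa> n)[i := v])) has_field_derivative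
       (\<Sum>j\<le>J1. p j * 0) + (\<Sum>j\<le>J2. q j * (if j = i then 1 else 0))) (at (\<kappa> (n + int i)))"
      unfolding window_update window_def[of J1] by (rule chain) auto
    then show ?thesis
      using that unfolding dL_dkappa_def
      by (auto intro!: DERIV_imp_deriv simp: if_distrib[of "\<lambda>x. _ * x"] sum.delta cong: if_cong)
  qed
  have "((\<lambda>v. L (window J1 (T v) n) (window J2 (K v) n)) has_field_derivative
      (\<Sum>j\<le>J1. p j * T' (n + int j)) + (\<Sum>j\<le>J2. q j * K' (n + int j))) (at u)"
    unfolding window_def by (rule chain) (use T K in auto)
  then show ?thesis by (simp add: p q)
qed

text \<open>
  Summation by parts on the lattice: a variation at the site \<open>n\<close> changes an invariant only at
  the sites \<open>n - r, ..., n\<close>, and collecting the terms of the varied Lagrangian by those sites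
  moves the shifts onto the partial derivatives, which is how the Euler operators arise.  The
  bound on \<open>M\<close> guarantees that no term is lost.
\<close>

lemma sum_shifted_support:
  fixes T :: "int \<Rightarrow> 'a::comm_ring_1" and P :: "nat \<Rightarrow> int \<Rightarrow> 'a"
  assumes "J + r \<le> M" and T: "\<And>m. m > n \<or> m < n - int r \<Longrightarrow> T m = 0"
  shows "(\<Sum>j\<le>M. \<Sum>i\<le>J. P i (n - int j) * T (n - int j + int i))
       = (\<Sum>d\<le>r. (\<Sum>i\<le>J. shift (- int i) (P i) (n - int d)) * T (n - int d))"
proof -
  have "(\<Sum>j\<le>M. P i (n - int j) * T (n - int j + int i)) = (\<Sum>d\<le>r. P i (n - int d - int i) * T (n - int d))"
    if "i \<le> J" for i
  proof -
    have "(\<Sum>d\<le>r. P i (n - int d - int i) * T (n - int d))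
        = (\<Sum>j\<in>(\<lambda>d. d + i) ` {..r}. P i (n - int j) * T (n - int j + int i))"
      by (subst sum.reindex) (auto simp: algebra_simps)
    also have "\<dots> = (\<Sum>j\<le>M. P i (n - int j) * T (n - int j + int i))"
    proof (rule sum.mono_neutral_left)
      show "\<forall>j\<in>{..M} - (\<lambda>d. d + i) ` {..r}. P i (n - int j) * T (n - int j + int i) = 0"
      proof
        fix j assume "j \<in> {..M} - (\<lambda>d. d + i) ` {..r}"
        then have "\<not> (\<exists>d\<le>r. j = d + i)" by auto
        then have "j < i \<or> j > r + i"
          by (metis le_add_diff_inverse2 le_diff_conv not_le)
        then have "T (n - int j + int i) = 0" by (intro T) auto
        then show "P i (n - int j) * T (n - int j + int i) = 0" by simp
      qed
    qed (use assms(1) that in auto)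
    finally show ?thesis by simp
  qed
  then have "(\<Sum>i\<le>J. \<Sum>j\<le>M. P i (n - int j) * T (n - int j + int i))
      = (\<Sum>i\<le>J. \<Sum>d\<le>r. P i (n - int d - int i) * T (n - int d))"
    by - (rule sum.cong[OF refl], simp)
  then show ?thesis
    by (subst sum.swap) (simp add: sum.swap[of _ "{..J}" "{..r}"] sum_distrib_right shift_def)
qed

section \<open>The Euler operators of the plane sequence in invariant form\<close>

text \<open>
  The oriented area of the parallelogram on two vectors is linear in each of them, which is
  what makes the variations of \<open>\<tau>\<close> and \<open>\<kappa>\<close> easy to compute.
\<close>

definition area :: "'a::real_normed_field^2 \<Rightarrow> 'a^2 \<Rightarrow> 'a" where
  "area v w = v$1 * w$2 - w$1 * v$2"

lemma area_add:
  "area (v + c *s e) w = area v w + c * area e w"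
  "area v (w + c *s e) = area v w + c * area v e"
  by (simp_all add: area_def algebra_simps)

lemma area_swap: "area v w = - area w v" by (simp add: area_def)

lemma tau_of_area: "tau_of z n = area (z n) (z (n+1))"
  by (simp add: tau_of_def area_def)

lemma kappa_of_area: "kappa_of z n = area (z n) (z (n+2)) / tau_of z (n+1)"
  by (simp add: kappa_of_def tau_of_def area_def add.assoc)

lemma has_field_derivative_area:
  "((\<lambda>v. area (w + (v - u) *s e) x) has_field_derivative area e x) (at u)"
  "((\<lambda>v. area x (w + (v - u) *s e)) has_field_derivative area x e) (at u)"
  unfolding area_add by (auto intro!: derivative_eq_intros)

lemma has_field_derivative_tau_of:
  fixes z :: "int \<Rightarrow> 'a::real_normed_field^2" and e :: "'a^2"
  shows "((\<lambda>v. tau_of (z(n := z n + (v - u) *s e)) m) has_field_derivative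
     (if m = n then area e (z (n+1)) else if m = n-1 then area (z (n-1)) e else 0)) (at u)"
  by (auto simp: tau_of_area simp del: vector_sub_rdistrib intro!: has_field_derivative_area)

text \<open>
  The point at \<open>n\<close> enters \<open>\<kappa>\<close> at three sites: as first point at \<open>n\<close>, through the
  denominator alone at \<open>n - 1\<close>, and as last point of both determinants at \<open>n - 2\<close>.
\<close>

lemma has_field_derivative_kappa_of:
  fixes z :: "int \<Rightarrow> 'a::real_normed_field^2" and e :: "'a^2"
  assumes nz: "\<And>n. tau_of z n \<noteq> 0"
  shows "((\<lambda>v. kappa_of (z(n := z n + (v - u) *s e)) m) has_field_derivative
     (if m = n then area e (z (n+2)) / tau_of z (n+1)
      else if m = n-1 then - (kappa_of z (n-1) / tau_of z n) * area e (z (n+1))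
      else if m = n-2 then (area (z (n-2)) e - kappa_of z (n-2) * area (z (n-1)) e) / tau_of z (n-1)
      else 0)) (at u)"
proof -
  define Z where "Z v = z(n := z n + (v - u) *s e)" for v
  have Z: "Z u = z" by (simp add: Z_def)
  have "((\<lambda>v. area (Z v m) (Z v (m+2))) has_field_derivative
     (if m = n then area e (z (n+2)) else if m = n-2 then area (z (n-2)) e else 0)) (at u)"
    by (auto simp: Z_def simp del: vector_sub_rdistrib intro!: has_field_derivative_area)
  from DERIV_divide[OF this has_field_derivative_tau_of[of z n u e "m+1", folded Z_def]]
  show ?thesis
    using nz unfolding Z_def[symmetric] kappa_of_area
    by - (rule DERIV_cong, auto simp: Z field_simps)
qed

text \<open>
  A coordinate of \<open>z n\<close> enters \<open>\<tau>\<close> at two sites and \<open>\<kappa>\<close> at three.  This explains the five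
  terms, each an invariant Euler operator times the derivative of an invariant, and the range
  of the sum in \<open>E_xy\<close>: a shift of at most \<open>J1\<close> or \<open>J2\<close> from the Lagrangian, plus at most
  \<open>1\<close> or \<open>2\<close> from the invariant.
\<close>

lemma E_xy_eq:
  fixes L :: "'a::real_normed_field lagrangian" and i :: 2
  defines "e \<equiv> axis i (1::'a)"
  assumes L_diff: "\<And>n. lagrangian_differentiable_at L (window J1 (tau_of z) n) (window J2 (kappa_of z) n)"
    and nz: "\<And>n. tau_of z n \<noteq> 0"
  defines "Ek \<equiv> E_kappa L J1 J2 (kappa_of z) (tau_of z)"
    and "Et \<equiv> E_tau L J1 J2 (kappa_of z) (tau_of z)"
  shows "E_xy L J1 J2 i z n =
      Et n * area e (z (n+1)) + Et (n-1) * area (z (n-1)) e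
      + Ek n * (area e (z (n+2)) / tau_of z (n+1))
      - Ek (n-1) * (kappa_of z (n-1) / tau_of z n) * area e (z (n+1))
      + Ek (n-2) * ((area (z (n-2)) e - kappa_of z (n-2) * area (z (n-1)) e) / tau_of z (n-1))"
proof -
  define T where "T m = (if m = n then area e (z (n+1)) else if m = n-1 then area (z (n-1)) e else 0)" for m
  define K where "K m = (if m = n then area e (z (n+2)) / tau_of z (n+1)
      else if m = n-1 then - (kappa_of z (n-1) / tau_of z n) * area e (z (n+1))
      else if m = n-2 then (area (z (n-2)) e - kappa_of z (n-2) * area (z (n-1)) e) / tau_of z (n-1)
      else 0)" for m
  let ?Z = "\<lambda>v. z(n := z n + (v - z n $ i) *s e)"
  have Z: "(\<chi> i'. if i' = i then v else z n $ i') = z n + (v - z n $ i) *s e" for v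
    by (auto simp: vec_eq_iff e_def axis_def)
  have "((\<lambda>v. lagrangian_xy L J1 J2 (?Z v) m) has_field_derivative
      (\<Sum>j\<le>J1. dL_dtau L J1 J2 (kappa_of z) (tau_of z) j m * T (m + int j))
      + (\<Sum>j\<le>J2. dL_dkappa L J1 J2 (kappa_of z) (tau_of z) j m * K (m + int j))) (at (z n $ i))" for m
    unfolding lagrangian_xy_def T_def K_def
    by (rule window_chain_rule[OF L_diff _ has_field_derivative_tau_of _ has_field_derivative_kappa_of[OF nz]]) simp_all
  then have "E_xy L J1 J2 i z n = (\<Sum>j\<le>max (J1 + 1) (J2 + 2).
      (\<Sum>l\<le>J1. dL_dtau L J1 J2 (kappa_of z) (tau_of z) l (n - int j) * T (n - int j + int l))
      + (\<Sum>l\<le>J2. dL_dkappa L J1 J2 (kappa_of z) (tau_of z) l (n - int j) * K (n - int j + int l)))"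
    unfolding E_xy_def Z by (intro sum.cong refl DERIV_imp_deriv)
  also have "\<dots> = (\<Sum>d\<le>1. Et (n - int d) * T (n - int d)) + (\<Sum>d\<le>2. Ek (n - int d) * K (n - int d))"
    unfolding sum.distrib Et_def Ek_def E_tau_def E_kappa_def
    by (intro arg_cong2[of _ _ _ _ "(+)"] sum_shifted_support) (auto simp: T_def K_def)
  finally show ?thesis
    by (simp add: T_def K_def numeral_2_eq_2)
qed

text \<open>
  The three-term recurrence reduces the areas spanned by \<open>e\<close> and the points near \<open>z n\<close> to
  those spanned by \<open>e\<close> with \<open>z n\<close> and \<open>z (n + 1)\<close>.  The two coefficients that remain are, up
  to the factors \<open>1 / \<tau>\<^sub>n\<close> and \<open>- 1\<close>, the expressions that the invariant Euler-Lagrange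
  equations set to zero.
\<close>

lemma E_xy_invariant:
  fixes L :: "'a::real_normed_field lagrangian" and i :: 2
  defines "e \<equiv> axis i (1::'a)"
  assumes L_diff: "\<And>n. lagrangian_differentiable_at L (window J1 (tau_of z) n) (window J2 (kappa_of z) n)"
    and nz: "\<And>n. tau_of z n \<noteq> 0"
  defines "\<kappa> \<equiv> kappa_of z" and "\<tau> \<equiv> tau_of z"
    and "Ek \<equiv> E_kappa L J1 J2 (kappa_of z) (tau_of z)"
    and "Et \<equiv> E_tau L J1 J2 (kappa_of z) (tau_of z)"
  shows "E_xy L J1 J2 i z n =
      (\<kappa> n * Ek n - \<kappa> (n-1) * Ek (n-1) + \<tau> n * Et n + \<tau> (n-1) * Et (n-1)) / \<tau> n * area e (z (n+1))
      - (Ek n / \<tau> n + \<kappa> (n-1) * Et (n-1) - \<tau> (n-2) / (\<tau> (n-1))^2 * Ek (n-2)) * area e (z n)"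
proof -
  have nz': "\<tau> n \<noteq> 0" for n using nz by (simp add: \<tau>_def)
  have rec: "area v (z (n+2)) / \<tau> (n+1) = (\<kappa> n * area v (z (n+1)) - area v (z n)) / \<tau> n" for n v
  proof -
    have "area v (z (n+2)) / \<tau> (n+1)
        = v$1 * (z (n+2) $ 2 / \<tau> (n+1)) - z (n+2) $ 1 / \<tau> (n+1) * v$2"
      by (simp add: area_def diff_divide_distrib)
    also have "\<dots> = (\<kappa> n * area v (z (n+1)) - area v (z n)) / \<tau> n"
      unfolding \<tau>_def \<kappa>_def three_term_recurrence[OF nz nz]
      using nz[of n] by (simp add: area_def field_simps)
    finally show ?thesis .
  qed
  have r0: "area e (z (n+2)) / \<tau> (n+1) = (\<kappa> n * area e (z (n+1)) - area e (z n)) / \<tau> n"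
    by (rule rec)
  have r1: "area (z (n-1)) e = \<tau> (n-1) / \<tau> n * area e (z (n+1)) - \<kappa> (n-1) * area e (z n)"
    using rec[of e "n-1"] nz'[of n] nz'[of "n-1"]
    by (simp add: area_swap[of "z (n-1)" e] field_simps)
  have r2: "area (z (n-2)) e - \<kappa> (n-2) * area (z (n-1)) e = \<tau> (n-2) / \<tau> (n-1) * area e (z n)"
    using rec[of e "n-2"] nz'[of "n-1"] nz'[of "n-2"]
    by (simp add: area_swap[of "z (n-1)" e] area_swap[of "z (n-2)" e] field_simps)
  show ?thesis
    unfolding e_def E_xy_eq[OF L_diff nz]
    unfolding e_def[symmetric] Ek_def[symmetric] Et_def[symmetric]
    unfolding \<kappa>_def[symmetric] \<tau>_def[symmetric] r0 r2
    unfolding r1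
    using nz'[of n] nz'[of "n-1"] by (simp add: field_simps power2_eq_square)
qed

lemma invariant_EL_imp_solves_EL:
  assumes L_diff: "\<And>n. lagrangian_differentiable_at L (window J1 (tau_of z) n) (window J2 (kappa_of z) n)"
    and nz: "\<And>n. tau_of z n \<noteq> 0"
    and EL: "invariant_EL L J1 J2 (kappa_of z) (tau_of z)"
  shows "solves_EL L J1 J2 z"
  unfolding solves_EL_def E_xy_invariant[OF L_diff nz] invariant_EL_eqs[OF EL] by simp

section \<open>Explicit solution of the frame recursion\<close>

text \<open>
  Multiplying \<open>k = V v* Ad g\<close> by \<open>Ad (inverse g)\<close> and keeping the first two components
  gives, for fixed second row \<open>(c, d)\<close>, a linear equation for the first row \<open>(a, b)\<close> and the
  relation \<open>V\<^sub>2 = k\<^sub>1 c d + k\<^sub>2 d\<^sup>2 - k\<^sub>3 c\<^sup>2\<close>.  Together with \<open>a d - b c = 1\<close> this is a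
  system with determinant \<open>2 V\<^sub>2\<close>, and Cramer's rule yields the first row as a linear
  function of the second.
\<close>

lemma frame_linear_recursion:
  fixes g :: "'a::real_normed_field^2^2" and V k :: "'a^3"
  assumes det: "det g = 1" and k: "k = V v* Ad g" and V2: "V $ 2 \<noteq> 0"
  defines "c \<equiv> g$2$1" and "d \<equiv> g$2$2"
  shows "g$1$1 = ((V$1 + k$1) * c + 2 * k$2 * d) / (2 * V$2)"
    and "g$1$2 = (2 * k$3 * c + (V$1 - k$1) * d) / (2 * V$2)"
proof -
  have det': "g$1$1 * d - g$1$2 * c = 1" using det by (simp add: det_2 c_def d_def)
  have k1: "k$1 = V$1 * (g$1$1 * d + g$1$2 * c) - 2 * V$2 * g$1$1 * g$1$2 + 2 * V$3 * c * d"
    and k2: "k$2 = - V$1 * g$1$1 * c + V$2 * (g$1$1)^2 - V$3 * c^2"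
    and k3: "k$3 = V$1 * g$1$2 * d - V$2 * (g$1$2)^2 + V$3 * d^2"
    by (simp_all add: k vector_mult_Ad_nth Ad_nth c_def d_def algebra_simps)
  have "(V$1 + k$1) * c + 2 * k$2 * d = 2 * V$2 * g$1$1"
    using det' unfolding k1 k2 by algebra
  moreover have "2 * k$3 * c + (V$1 - k$1) * d = 2 * V$2 * g$1$2"
    using det' unfolding k1 k3 by algebra
  ultimately show "g$1$1 = ((V$1 + k$1) * c + 2 * k$2 * d) / (2 * V$2)"
    "g$1$2 = (2 * k$3 * c + (V$1 - k$1) * d) / (2 * V$2)"
    using V2 by simp_all
qed

lemma vec2_eq_iff: "v = w \<longleftrightarrow> v$1 = w$1 \<and> v$2 = w$2" for v w :: "'a^2"
  by (simp add: vec_eq_iff forall_2)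

lemma matrix_vector_mult_2_nth: "(A *v v) $ i = A$i$1 * v$1 + A$i$2 * v$2" for A :: "'a::semiring_1^2^2"
  by (simp add: matrix_vector_mult_def sum_2)

text \<open>
  The transfer matrix from \<open>(c\<^sub>l, d\<^sub>l)\<close> to \<open>(c\<^sub>l\<^sub>+\<^sub>1, d\<^sub>l\<^sub>+\<^sub>1)\<close> is, up to the factor
  \<open>\<zeta>\<^sub>l\<close>, the scalar \<open>V\<^sup>1\<^sub>l\<close> plus the constant matrix with rows \<open>(k\<^sub>1, 2 k\<^sub>2)\<close> and
  \<open>(2 k\<^sub>3, - k\<^sub>1)\<close>.  The latter is traceless with eigenvalues \<open>- s\<close> and \<open>s\<close>, and the columns
  of \<open>Q\<close> are its eigenvectors.  So \<open>Q\<close> diagonalises all transfer matrices at once and their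
  ordered product is a product of scalars.
\<close>

lemma explicit_formula_of_recursion:
  fixes k :: "complex^3" and V :: "int \<Rightarrow> complex^3" and c d :: "nat \<Rightarrow> complex"
  assumes s: "s^2 = (k$1)^2 + 4 * k$2 * k$3" and nz: "k$3 * s \<noteq> 0"
    and c: "\<And>l. c (Suc l) = zeta V \<tau> (int l) * ((V (int l) $ 1 + k$1) * c l + 2 * k$2 * d l)"
    and d: "\<And>l. d (Suc l) = zeta V \<tau> (int l) * (2 * k$3 * c l + (V (int l) $ 1 - k$1) * d l)"
  shows "explicit_formula s k V \<tau> (c 0) (d 0) n = vector [d n, - c n]"
proof -
  define Q where "Q = Q_mat s k"
  define D where "D n = mat2 (\<Prod>l<n. zeta V \<tau> (int l) * (V (int l) $ 1 - s)) 0
              0 (\<Prod>l<n. zeta V \<tau> (int l) * (V (int l) $ 1 + s))" for n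
  define M where "M l = mat2 (zeta V \<tau> (int l) * (V (int l) $ 1 + k$1)) (zeta V \<tau> (int l) * 2 * k$2)
     (zeta V \<tau> (int l) * 2 * k$3) (zeta V \<tau> (int l) * (V (int l) $ 1 - k$1))" for l
  define \<Lambda> where "\<Lambda> l = mat2 (zeta V \<tau> (int l) * (V (int l) $ 1 - s)) 0
              0 (zeta V \<tau> (int l) * (V (int l) $ 1 + s))" for l
  define w :: "complex^2" where "w = vector [c 0, d 0]"
  have "det Q = - 4 * (k$3 * s)"
    by (simp add: det_2 Q_def Q_mat_def algebra_simps)
  then have "invertible Q" using nz by (simp add: invertible_det_nz)
  then have Q: "Q ** matrix_inv Q = mat 1"
    unfolding invertible_def matrix_inv_def by (rule someI_ex[THEN conjunct1])
  have ss: "s * (s * x) = k$1 * (k$1 * x) + 4 * (x * (k$2 * k$3))" for x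
  proof -
    have "s * (s * x) = s^2 * x" by (simp add: power2_eq_square mult.assoc)
    then show ?thesis unfolding s by (simp add: power2_eq_square algebra_simps)
  qed
  have diag: "M l ** Q = Q ** \<Lambda> l" for l
    by (simp add: matrix_2_eq_iff matrix_mult_2_nth M_def \<Lambda>_def Q_def Q_mat_def algebra_simps ss)
  have D_Suc: "D (Suc n) = \<Lambda> n ** D n" for n
    by (simp add: matrix_2_eq_iff matrix_mult_2_nth D_def \<Lambda>_def mult.commute)
  have "vector [c n, d n] = (Q ** D n ** matrix_inv Q) *v w"
  proof (induction n)
    case 0
    have "D 0 = mat 1" by (simp add: D_def matrix_2_eq_iff mat_def)
    then show ?case by (simp add: Q w_def)
  next
    case (Suc n)
    have "vector [c (Suc n), d (Suc n)] = M n *v vector [c n, d n]"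
      by (simp add: vec2_eq_iff matrix_vector_mult_2_nth M_def c d algebra_simps)
    also have "\<dots> = ((M n ** Q) ** D n ** matrix_inv Q) *v w"
      unfolding Suc.IH by (simp add: matrix_vector_mul_assoc matrix_mul_assoc)
    also have "\<dots> = (Q ** D (Suc n) ** matrix_inv Q) *v w"
      unfolding diag D_Suc by (simp add: matrix_mul_assoc)
    finally show ?case .
  qed
  then have "explicit_formula s k V \<tau> (c 0) (d 0) n = mat2 0 1 (-1) 0 *v vector [c n, d n]"
    by (simp add: explicit_formula_def Q_def D_def w_def matrix_vector_mul_assoc matrix_mul_assoc)
  then show ?thesis by (simp add: vec2_eq_iff matrix_vector_mult_2_nth)
qed

text \<open>
  Being a homomorphism between fields, \<open>emb\<close> is injective, so it carries identities between
  the real or complex data over to the closed formula and back.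
\<close>

locale field_embedding =
  fixes emb :: "'a::real_normed_field \<Rightarrow> complex"
  assumes linear: "linear emb" and one: "emb 1 = 1" and mult: "emb (u * v) = emb u * emb v"
begin

lemma add: "emb (u + v) = emb u + emb v" by (rule linear_add[OF linear])
lemma diff: "emb (u - v) = emb u - emb v" by (rule linear_diff[OF linear])
lemma minus: "emb (- u) = - emb u" by (rule linear_neg[OF linear])
lemma zero: "emb 0 = 0" by (rule linear_0[OF linear])
lemma two: "emb 2 = 2" using add[of 1 1] by (simp add: one)

lemma eq_0_iff: "emb u = 0 \<longleftrightarrow> u = 0"
proof
  assume "emb u = 0"
  then have "emb (u * inverse u) = 0" by (simp add: mult)
  then show "u = 0" by (metis one right_inverse zero_neq_one)
qed (simp add: zero)

lemma eq_iff: "emb u = emb v \<longleftrightarrow> u = v"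
  using eq_0_iff[of "u - v"] by (simp add: diff)

lemma divide: "emb (u / v) = emb u / emb v"
proof (cases "v = 0")
  case False
  then have "emb u = emb (u / v) * emb v" by (simp flip: mult)
  then show ?thesis using False by (simp add: eq_0_iff)
qed (simp add: zero)

lemmas hom = add diff minus zero one two mult divide

lemma map_vec_inj: "map_vec emb v = map_vec emb w \<longleftrightarrow> v = w"
  by (simp add: map_vec_def vec_eq_iff eq_iff)

end

lemma map_vec_nth [simp]: "map_vec f v $ i = f (v $ i)"
  by (simp add: map_vec_def)

text \<open>
  The second row of \<open>frame_step\<close> reads \<open>(c\<^sub>l\<^sub>+\<^sub>1, d\<^sub>l\<^sub>+\<^sub>1) = - \<tau>\<^sub>l (a\<^sub>l, b\<^sub>l)\<close>, and conservation
  turns the right-hand side into a linear function of \<open>(c\<^sub>l, d\<^sub>l)\<close>, which produces the factor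
  \<open>\<zeta>\<^sub>l = - \<tau>\<^sub>l / (2 V\<^sup>2\<^sub>l)\<close>.
\<close>

lemma explicit_formula_of_conserved:
  fixes z :: "int \<Rightarrow> 'a::real_normed_field^2" and V :: "int \<Rightarrow> 'a^3"
  assumes emb: "field_embedding emb"
    and nz: "\<And>n. tau_of z n \<noteq> 0" and V2: "\<And>n. V n $ 2 \<noteq> 0"
    and k: "\<And>n. k = V n v* Ad (frame z n)"
    and k_nz: "k$3 * ((k$1)^2 + 4 * k$2 * k$3) \<noteq> 0"
    and s: "s^2 = emb ((k$1)^2 + 4 * k$2 * k$3)"
  shows "map_vec emb (z (int n)) =
     explicit_formula s (map_vec emb k) (\<lambda>l. map_vec emb (V l)) (\<lambda>l. emb (tau_of z l))
       (emb (frame z 0 $ 2 $ 1)) (emb (frame z 0 $ 2 $ 2)) n"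
proof -
  interpret field_embedding emb by (rule emb)
  define c where "c l = frame z (int l) $ 2 $ 1" for l
  define d where "d l = frame z (int l) $ 2 $ 2" for l
  have step: "c (Suc l) = - tau_of z (int l) * frame z (int l) $ 1 $ 1"
    "d (Suc l) = - tau_of z (int l) * frame z (int l) $ 1 $ 2" for l
    using nz by (simp_all add: c_def d_def add.commute)
  have four: "emb 4 = 4" using add[of 2 2] by (simp add: two)
  have "explicit_formula s (map_vec emb k) (\<lambda>l. map_vec emb (V l)) (\<lambda>l. emb (tau_of z l))
       (emb (c 0)) (emb (d 0)) n = vector [emb (d n), - emb (c n)]"
  proof (rule explicit_formula_of_recursion)
    show "s^2 = (map_vec emb k $ 1)^2 + 4 * map_vec emb k $ 2 * map_vec emb k $ 3"
      using s by (simp add: hom four power2_eq_square)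
    have "emb ((k$1)^2 + 4 * k$2 * k$3) \<noteq> 0" "emb (k$3) \<noteq> 0"
      using k_nz by (simp_all add: eq_0_iff)
    then show "map_vec emb k $ 3 * s \<noteq> 0" using s by auto
  next
    fix l
    note a = frame_linear_recursion[OF det_frame[OF nz] k V2, of "int l", folded c_def d_def]
    show "emb (c (Suc l)) = zeta (\<lambda>l. map_vec emb (V l)) (\<lambda>l. emb (tau_of z l)) (int l) *
        ((map_vec emb (V (int l)) $ 1 + map_vec emb k $ 1) * emb (c l) + 2 * map_vec emb k $ 2 * emb (d l))"
      unfolding step a by (simp add: zeta_def hom)
    show "emb (d (Suc l)) = zeta (\<lambda>l. map_vec emb (V l)) (\<lambda>l. emb (tau_of z l)) (int l) *
        (2 * map_vec emb k $ 3 * emb (c l) + (map_vec emb (V (int l)) $ 1 - map_vec emb k $ 1) * emb (d l))"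
      unfolding step a by (simp add: zeta_def hom)
  qed
  then show ?thesis by (simp add: c_def d_def vec2_eq_iff hom)
qed

theorem theorem2p2:
  fixes L :: "'a::real_normed_field lagrangian" and J1 J2 :: nat
    and \<kappa> \<tau> :: "int \<Rightarrow> 'a" and k :: "'a^3"
    and emb :: "'a \<Rightarrow> complex" and s :: complex
  assumes emb: "linear emb" "emb 1 = 1" "\<And>u v. emb (u * v) = emb u * emb v"
    and L_diff: "\<And>n. lagrangian_differentiable_at L (window J1 \<tau> n) (window J2 \<kappa> n)"
    and tau_nz: "\<And>n. \<tau> n \<noteq> 0"
    and EL: "invariant_EL L J1 J2 \<kappa> \<tau>"
    and V2_nz: "\<And>n. V_inv L J1 J2 \<kappa> \<tau> n $ 2 \<noteq> 0"
    and k_nz: "k$3 * ((k$1)^2 + 4 * k$2 * k$3) \<noteq> 0"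
    and s: "s^2 = emb ((k$1)^2 + 4 * k$2 * k$3)"
  shows
    "(\<forall>z. solves_EL L J1 J2 z \<and> kappa_of z = \<kappa> \<and> tau_of z = \<tau> \<and>
          k = V_inv L J1 J2 \<kappa> \<tau> 0 v* Ad (frame z 0) \<longrightarrow>
        (\<forall>n::nat. map_vec emb (z (int n)) =
           explicit_formula s (map_vec emb k) (\<lambda>l. map_vec emb (V_inv L J1 J2 \<kappa> \<tau> l))
             (\<lambda>l. emb (\<tau> l)) (emb (frame z 0 $ 2 $ 1)) (emb (frame z 0 $ 2 $ 2)) n))
     \<and>
     (\<forall>c0 d0. (\<exists>a0 b0. a0 * d0 - b0 * c0 = 1 \<and>
                       k = V_inv L J1 J2 \<kappa> \<tau> 0 v* Ad (mat2 a0 b0 c0 d0)) \<longrightarrow>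
        (\<exists>!z. solves_EL L J1 J2 z \<and> kappa_of z = \<kappa> \<and> tau_of z = \<tau> \<and>
              (\<forall>n. k = V_inv L J1 J2 \<kappa> \<tau> n v* Ad (frame z n)) \<and>
              (\<forall>n::nat. map_vec emb (z (int n)) =
                 explicit_formula s (map_vec emb k) (\<lambda>l. map_vec emb (V_inv L J1 J2 \<kappa> \<tau> l))
                   (\<lambda>l. emb (\<tau> l)) (emb c0) (emb d0) n)))"
proof (intro conjI allI impI)
  interpret field_embedding emb by (rule field_embedding.intro) (fact emb)+
  have conserved: "V_inv L J1 J2 \<kappa> \<tau> n v* Ad (frame z n) = V_inv L J1 J2 \<kappa> \<tau> 0 v* Ad (frame z 0)"
    if "kappa_of z = \<kappa>" "tau_of z = \<tau>" for z n
    using conservation_law[OF tau_nz EL that] .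
  have formula: "map_vec emb (z (int n)) =
      explicit_formula s (map_vec emb k) (\<lambda>l. map_vec emb (V_inv L J1 J2 \<kappa> \<tau> l))
             (\<lambda>l. emb (\<tau> l)) (emb (frame z 0 $ 2 $ 1)) (emb (frame z 0 $ 2 $ 2)) n"
    if z: "kappa_of z = \<kappa>" "tau_of z = \<tau>"
      and k: "k = V_inv L J1 J2 \<kappa> \<tau> 0 v* Ad (frame z 0)" for z and n :: nat
  proof -
    have "k = V_inv L J1 J2 \<kappa> \<tau> n v* Ad (frame z n)" for n
      by (rule trans[OF k conserved[OF z, symmetric]])
    from explicit_formula_of_conserved[OF field_embedding_axioms _ V2_nz this k_nz s] tau_nz z
    show ?thesis by simp
  qed
  show "map_vec emb (z (int n)) =
           explicit_formula s (map_vec emb k) (\<lambda>l. map_vec emb (V_inv L J1 J2 \<kappa> \<tau> l))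
             (\<lambda>l. emb (\<tau> l)) (emb (frame z 0 $ 2 $ 1)) (emb (frame z 0 $ 2 $ 2)) n"
    if "solves_EL L J1 J2 z \<and> kappa_of z = \<kappa> \<and> tau_of z = \<tau> \<and>
          k = V_inv L J1 J2 \<kappa> \<tau> 0 v* Ad (frame z 0)" for z and n :: nat
    using that formula by blast
  fix c0 d0
  assume "\<exists>a0 b0. a0 * d0 - b0 * c0 = 1 \<and> k = V_inv L J1 J2 \<kappa> \<tau> 0 v* Ad (mat2 a0 b0 c0 d0)"
  then obtain a0 b0 where det0: "a0 * d0 - b0 * c0 = 1"
    and k: "k = V_inv L J1 J2 \<kappa> \<tau> 0 v* Ad (mat2 a0 b0 c0 d0)" by blast
  define F where "F n g = K_mat (\<kappa> n) (\<tau> n) ** g" for n and g :: "'a^2^2"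
  have F: "bij (F n)" for n
    unfolding F_def using K_mat_bij[OF tau_nz] .
  obtain \<rho> where \<rho>: "\<rho> 0 = mat2 a0 b0 c0 d0" "\<And>n. \<rho> (n+1) = F n (\<rho> n)"
    using int_recursion_exists[of F] F bij_is_surj by metis
  obtain z where z: "tau_of z = \<tau>" "kappa_of z = \<kappa>" "frame z = \<rho>"
  proof (rule sequence_from_frame[OF tau_nz])
    show "\<rho> (n+1) = K_mat (\<kappa> n) (\<tau> n) ** \<rho> n" for n
      using \<rho>(2) by (simp add: F_def)
    show "det (\<rho> 0) = 1" using det0 by (simp add: \<rho> det_2)
  qed
  show "\<exists>!z. solves_EL L J1 J2 z \<and> kappa_of z = \<kappa> \<and> tau_of z = \<tau> \<and>
              (\<forall>n. k = V_inv L J1 J2 \<kappa> \<tau> n v* Ad (frame z n)) \<and>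
              (\<forall>n::nat. map_vec emb (z (int n)) =
                 explicit_formula s (map_vec emb k) (\<lambda>l. map_vec emb (V_inv L J1 J2 \<kappa> \<tau> l))
                   (\<lambda>l. emb (\<tau> l)) (emb c0) (emb d0) n)"
  proof (intro ex1I[of _ z] conjI allI)
    have k0: "k = V_inv L J1 J2 \<kappa> \<tau> 0 v* Ad (frame z 0)" by (simp add: k z \<rho>)
    show "solves_EL L J1 J2 z"
      using invariant_EL_imp_solves_EL[of L J1 z J2] L_diff tau_nz EL z by simp
    show "k = V_inv L J1 J2 \<kappa> \<tau> n v* Ad (frame z n)" for n
      by (rule trans[OF k0 conserved[OF z(2,1), symmetric]])
    show "map_vec emb (z (int n)) =
                 explicit_formula s (map_vec emb k) (\<lambda>l. map_vec emb (V_inv L J1 J2 \<kappa> \<tau> l))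
                   (\<lambda>l. emb (\<tau> l)) (emb c0) (emb d0) n" for n
      using formula[OF z(2,1) k0, of n] by (simp add: z(3) \<rho>(1))
  next
    fix z'
    assume z': "solves_EL L J1 J2 z' \<and> kappa_of z' = \<kappa> \<and> tau_of z' = \<tau> \<and>
              (\<forall>n. k = V_inv L J1 J2 \<kappa> \<tau> n v* Ad (frame z' n)) \<and>
              (\<forall>n::nat. map_vec emb (z' (int n)) =
                 explicit_formula s (map_vec emb k) (\<lambda>l. map_vec emb (V_inv L J1 J2 \<kappa> \<tau> l))
                   (\<lambda>l. emb (\<tau> l)) (emb c0) (emb d0) n)"
    have "k = V_inv L J1 J2 \<kappa> \<tau> 0 v* Ad (frame z 0)" by (simp add: k z \<rho>)
    then have "map_vec emb (z (int n)) = map_vec emb (z' (int n))" for n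
      using formula[OF z(2,1), of n] z' by (simp add: z(3) \<rho>(1))
    \<comment> \<open>the formula determines two neighbouring points, hence a frame; the frame recursion,
      unlike the formula, also reaches the negative sites\<close>
    then have "z (int n) = z' (int n)" for n by (simp add: map_vec_inj)
    from this[of 0] this[of 1] have "frame z' 0 = frame z 0"
      using z(1) z' by (simp add: matrix_2_eq_iff)
    moreover have "frame z' (n+1) = F n (frame z' n)" for n
      using frame_step[of z' n] z' tau_nz by (simp add: F_def)
    moreover have "frame z (n+1) = F n (frame z n)" for n
      using \<rho> z by simp
    ultimately have "frame z' = frame z"
      using int_recursion_unique[of F "frame z'" "frame z"] F bij_is_inj by blast
    then show "z' = z" by (rule frame_eq_imp_eq)
  qed (use z in simp_all)
qed

end
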